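(* Let $G$ be a finite group, let $I$ and $\Lambda$ be finite nonempty index sets, and let $P=(p_{\lambda i})$ be a $\Lambda\times I$ matrix with entries in $G$. Suppose that $|I|>1$ or $|\Lambda|>1$. Then: (1) If $G$ is abelian, then $\chi(\mathcal{G}(\mathcal{M}[G;I,\Lambda;P]))=|G|$. (2) If $G$ is non-abelian, then $\chi(\mathcal{G}(\mathcal{M}[G;I,\Lambda;P]))=|Z(G)|+\chi(\mathcal{G}(G))$.
   Context: The Rees matrix semigroup $\mathcal{M}[G;I,\Lambda;P]$ over the group $G$ is the set $I\times G\times\Lambda$ with multiplication $(i,x,\lambda)(j,y,\mu)=(i,xp_{\lambda j}y,\mu)$. The center of a semigroup $S$ is $Z(S)=\{x\in S: xy=yx\text{ for all }y\in S\}$. For a finite non-commutative semigroup $S$, the commuting graph $\mathcal{G}(S)$ is the simple graph with vertex set $S\setminus Z(S)$ in which two distinct vertices $x,y$ are adjacent if and only if $xy=yx$. (Under the hypotheses of the claim, $\mathcal{M}[G;I,\Lambda;P]$ is non-commutative.) $\chi(\Gamma)$ denotes the chromatic number of a graph $\Gamma$. *)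

theory Defs
  imports "HOL-Algebra.Group" "Graph_Theory.Pair_Digraph"
begin

text \<open>
  A semigroup is given by its carrier set and its multiplication, since the structures of
  \<^theory>\<open>HOL-Algebra.Group\<close> always carry a unit element. A group \<open>G\<close> is regarded as the
  semigroup with carrier \<open>carrier G\<close> and multiplication \<open>(\<otimes>\<^bsub>G\<^esub>)\<close>.
\<close>

definition semigroup_center :: "'a set \<Rightarrow> ('a \<Rightarrow> 'a \<Rightarrow> 'a) \<Rightarrow> 'a set" where
  "semigroup_center S m = {x \<in> S. \<forall>y\<in>S. m x y = m y x}"

text \<open>A simple graph is a symmetric loop-free digraph, as in \<^locale>\<open>pair_graph\<close>.\<close>

definition commuting_graph :: "'a set \<Rightarrow> ('a \<Rightarrow> 'a \<Rightarrow> 'a) \<Rightarrow> 'a pair_pre_digraph" where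
  "commuting_graph S m =
     \<lparr> pverts = S - semigroup_center S m,
       parcs = {(x, y). x \<in> S - semigroup_center S m \<and> y \<in> S - semigroup_center S m
                        \<and> x \<noteq> y \<and> m x y = m y x} \<rparr>"

lemma pair_graph_commuting_graph:
  assumes "finite S"
  shows "pair_graph (commuting_graph S m)"
proof -
  let ?V = "S - semigroup_center S m"
  have "parcs (commuting_graph S m) \<subseteq> ?V \<times> ?V"
    by (auto simp: commuting_graph_def)
  moreover have "finite (?V \<times> ?V)"
    using assms by simp
  ultimately have fin: "finite (parcs (commuting_graph S m))"
    by (rule finite_subset)
  have "sym (parcs (commuting_graph S m))"
    by (auto simp: commuting_graph_def sym_def)
  then show ?thesis
    using assms fin
    by unfold_locales (auto simp: commuting_graph_def symmetric_def)
qed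

definition proper_colouring :: "'a pair_pre_digraph \<Rightarrow> nat \<Rightarrow> ('a \<Rightarrow> nat) \<Rightarrow> bool" where
  "proper_colouring \<Gamma> k c \<longleftrightarrow>
     (\<forall>v\<in>pverts \<Gamma>. c v < k) \<and> (\<forall>(u, v)\<in>parcs \<Gamma>. c u \<noteq> c v)"

text \<open>Meaningful only if some proper colouring exists, in particular for finite simple graphs.\<close>

definition chromatic_number :: "'a pair_pre_digraph \<Rightarrow> nat" where
  "chromatic_number \<Gamma> = (LEAST k. \<exists>c. proper_colouring \<Gamma> k c)"

lemma ex_proper_colouring:
  assumes "pair_graph \<Gamma>"
  shows "\<exists>k c. proper_colouring \<Gamma> k c"
proof -
  interpret pair_graph \<Gamma> by (rule assms)
  obtain c :: "'a \<Rightarrow> nat" and k where c: "c ` pverts \<Gamma> = {i. i < k}" "inj_on c (pverts \<Gamma>)"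
    using finite_imp_inj_to_nat_seg[OF pair_finite_verts] by blast
  have "c v < k" if "v \<in> pverts \<Gamma>" for v
    using that c(1) by blast
  moreover have "c u \<noteq> c v" if "(u, v) \<in> parcs \<Gamma>" for u v
    using that c(2) in_arcsD1[OF that] in_arcsD2[OF that] pair_no_loops[OF that]
    by (auto dest: inj_onD)
  ultimately have "proper_colouring \<Gamma> k c"
    by (auto simp: proper_colouring_def)
  then show ?thesis by blast
qed

definition rees_carrier ::
  "('g, 'm) monoid_scheme \<Rightarrow> 'i set \<Rightarrow> 'l set \<Rightarrow> ('i \<times> 'g \<times> 'l) set" where
  "rees_carrier G I \<Lambda> = I \<times> carrier G \<times> \<Lambda>"

definition rees_mult ::
  "('g, 'm) monoid_scheme \<Rightarrow> ('l \<Rightarrow> 'i \<Rightarrow> 'g)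
     \<Rightarrow> 'i \<times> 'g \<times> 'l \<Rightarrow> 'i \<times> 'g \<times> 'l \<Rightarrow> 'i \<times> 'g \<times> 'l" where
  "rees_mult G P = (\<lambda>(i, x, l) (j, y, m). (i, x \<otimes>\<^bsub>G\<^esub> P l j \<otimes>\<^bsub>G\<^esub> y, m))"

lemma rees_mult_closed:
  assumes "group G" "\<forall>l\<in>\<Lambda>. \<forall>i\<in>I. P l i \<in> carrier G"
    and "a \<in> rees_carrier G I \<Lambda>" "b \<in> rees_carrier G I \<Lambda>"
  shows "rees_mult G P a b \<in> rees_carrier G I \<Lambda>"
proof -
  interpret group G by (rule assms)
  show ?thesis using assms(2-) by (auto simp: rees_carrier_def rees_mult_def)
qed

lemma rees_mult_assoc:
  assumes "group G" "\<forall>l\<in>\<Lambda>. \<forall>i\<in>I. P l i \<in> carrier G"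
    and "a \<in> rees_carrier G I \<Lambda>" "b \<in> rees_carrier G I \<Lambda>" "c \<in> rees_carrier G I \<Lambda>"
  shows "rees_mult G P (rees_mult G P a b) c = rees_mult G P a (rees_mult G P b c)"
proof -
  interpret group G by (rule assms)
  show ?thesis using assms(2-) by (auto simp: rees_carrier_def rees_mult_def m_assoc)
qed

end

theory Submission
  imports Defs
begin

text \<open>
  Two elements \<open>(i, x, l)\<close> and \<open>(j, y, m)\<close> of a Rees matrix semigroup can only commute if \<open>i = j\<close>
  and \<open>l = m\<close>, and then, writing \<open>p\<close> for \<open>P l i\<close>, they commute iff \<open>x p y = y p x\<close>, that is, iff
  \<open>p x\<close> and \<open>p y\<close> commute in \<open>G\<close>. As soon as there is more than one row or column, every element
  therefore fails to commute with some other one, so the center is empty, and the commuting graph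
  is a disjoint union of copies, one for each pair \<open>(i, l)\<close>, of the graph of distinct commuting
  elements on all of \<open>G\<close>, central elements included. A disjoint union of copies of a graph has the
  chromatic number of that graph; concretely, there are homomorphisms in both directions
  between the two graphs.

  On all of \<open>G\<close>, each central element is adjacent to every other element, so this graph is the join
  of a complete graph on \<open>Z(G)\<close> with the commuting graph of \<open>G\<close>, and the chromatic number of a join
  is the sum of the chromatic numbers. Thus
  \<open>\<chi>(\<G>(\<M>[G;I,\<Lambda>;P])) = |Z(G)| + \<chi>(\<G>(G))\<close>, whether or not \<open>G\<close> is abelian. For abelian \<open>G\<close> the
  commuting graph of \<open>G\<close> is empty and \<open>Z(G) = G\<close>, which gives the first claim as a special case.
\<close>

lemma chromatic_number_le:
  assumes "proper_colouring \<Gamma> k c"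
  shows "chromatic_number \<Gamma> \<le> k"
  unfolding chromatic_number_def using assms by (blast intro: Least_le)

lemma chromatic_number_attained:
  assumes "pair_graph \<Gamma>"
  obtains c where "proper_colouring \<Gamma> (chromatic_number \<Gamma>) c"
  using LeastI_ex[OF ex_proper_colouring[OF assms]] that
  unfolding chromatic_number_def by blast

text \<open>Colourings pull back along graph homomorphisms.\<close>

lemma chromatic_number_le_of_hom:
  assumes "pair_graph \<Delta>"
    and verts: "\<And>v. v \<in> pverts \<Gamma> \<Longrightarrow> h v \<in> pverts \<Delta>"
    and arcs: "\<And>u v. (u, v) \<in> parcs \<Gamma> \<Longrightarrow> (h u, h v) \<in> parcs \<Delta>"
  shows "chromatic_number \<Gamma> \<le> chromatic_number \<Delta>"
proof -
  obtain c where c: "proper_colouring \<Delta> (chromatic_number \<Delta>) c"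
    using chromatic_number_attained[OF assms(1)] .
  have "proper_colouring \<Gamma> (chromatic_number \<Delta>) (c \<circ> h)"
    using c verts arcs by (fastforce simp: proper_colouring_def)
  then show ?thesis by (rule chromatic_number_le)
qed

text \<open>
  The variant of the commuting graph that keeps the central elements as vertices. It is this graph,
  taken for the group, of which the commuting graph of a Rees matrix semigroup consists of copies.
\<close>

definition full_commuting_graph :: "'a set \<Rightarrow> ('a \<Rightarrow> 'a \<Rightarrow> 'a) \<Rightarrow> 'a pair_pre_digraph" where
  "full_commuting_graph S m =
     \<lparr> pverts = S, parcs = {(x, y). x \<in> S \<and> y \<in> S \<and> x \<noteq> y \<and> m x y = m y x} \<rparr>"

lemma pair_graph_full_commuting_graph:
  assumes "finite S"
  shows "pair_graph (full_commuting_graph S m)"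
proof -
  have "parcs (full_commuting_graph S m) \<subseteq> S \<times> S"
    by (auto simp: full_commuting_graph_def)
  then have fin: "finite (parcs (full_commuting_graph S m))"
    using assms by (meson finite_SigmaI finite_subset)
  have "sym (parcs (full_commuting_graph S m))"
    by (auto simp: full_commuting_graph_def sym_def)
  then show ?thesis
    using assms fin
    by unfold_locales (auto simp: full_commuting_graph_def symmetric_def)
qed

text \<open>
  The full commuting graph is the join of the complete graph on the center with the commuting
  graph. In a proper colouring the central elements take pairwise distinct colours that occur
  nowhere else, so the remaining colours suffice for the commuting graph; conversely, a colouring of
  the commuting graph extends by one new colour for each central element.
\<close>

lemma chromatic_number_full_commuting_graph:
  assumes fin: "finite S"
  shows "chromatic_number (full_commuting_graph S m)
           = card (semigroup_center S m) + chromatic_number (commuting_graph S m)"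
proof (rule antisym)
  let ?Z = "semigroup_center S m"
  have Zsub: "?Z \<subseteq> S" and finZ: "finite ?Z"
    using fin by (auto simp: semigroup_center_def)
  have central: "m x y = m y x" if "x \<in> ?Z" "y \<in> S" for x y
    using that by (auto simp: semigroup_center_def)

  let ?k = "chromatic_number (commuting_graph S m)"
  obtain c where c: "proper_colouring (commuting_graph S m) ?k c"
    using chromatic_number_attained[OF pair_graph_commuting_graph[OF fin]] .
  obtain g where g: "bij_betw g ?Z {0..<card ?Z}"
    using ex_bij_betw_finite_nat[OF finZ] by blast
  have g_less: "g x < card ?Z" if "x \<in> ?Z" for x
    using bij_betwE[OF g] that by simp
  have g_inj: "g x \<noteq> g y" if "x \<in> ?Z" "y \<in> ?Z" "x \<noteq> y" for x y
    using bij_betw_imp_inj_on[OF g] that by (auto dest: inj_onD)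
  have c_less: "c x < ?k" if "x \<in> S" "x \<notin> ?Z" for x
    using c that by (auto simp: proper_colouring_def commuting_graph_def)
  have c_ne: "c x \<noteq> c y"
    if "x \<in> S" "x \<notin> ?Z" "y \<in> S" "y \<notin> ?Z" "x \<noteq> y" "m x y = m y x" for x y
    using c that by (auto simp: proper_colouring_def commuting_graph_def)
  let ?d = "\<lambda>x. if x \<in> ?Z then ?k + g x else c x"
  have "?d x < card ?Z + ?k" if "x \<in> S" for x
    using g_less[of x] c_less[of x] that by auto
  moreover have "?d x \<noteq> ?d y" if "x \<in> S" "y \<in> S" "x \<noteq> y" "m x y = m y x" for x y
    using g_inj[of x y] c_ne[of x y] c_less[of x] c_less[of y] that by auto
  ultimately have "proper_colouring (full_commuting_graph S m) (card ?Z + ?k) ?d"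
    by (auto simp: proper_colouring_def full_commuting_graph_def)
  then show "chromatic_number (full_commuting_graph S m) \<le> card ?Z + ?k"
    by (rule chromatic_number_le)

  let ?n = "chromatic_number (full_commuting_graph S m)"
  obtain f where f: "proper_colouring (full_commuting_graph S m) ?n f"
    using chromatic_number_attained[OF pair_graph_full_commuting_graph[OF fin]] .
  have f_less: "f x < ?n" if "x \<in> S" for x
    using f that by (auto simp: proper_colouring_def full_commuting_graph_def)
  have f_ne: "f x \<noteq> f y" if "x \<in> S" "y \<in> S" "x \<noteq> y" "m x y = m y x" for x y
    using f that by (auto simp: proper_colouring_def full_commuting_graph_def)
  have f_ne_Z: "f x \<noteq> f y" if "x \<in> ?Z" "y \<in> S" "x \<noteq> y" for x y
    using f_ne[of x y] central[of x y] that Zsub by auto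
  define R where "R = {..<?n} - f ` ?Z"
  have "inj_on f ?Z"
    using f_ne_Z Zsub by (auto intro!: inj_onI)
  moreover have img: "f ` ?Z \<subseteq> {..<?n}"
    using f_less Zsub by auto
  ultimately have cardR: "card R = ?n - card ?Z" and le: "card ?Z \<le> ?n"
    using finZ card_mono[OF _ img] by (auto simp: R_def card_Diff_subset card_image)
  obtain r where r: "bij_betw r R {0..<card R}"
    using ex_bij_betw_finite_nat[of R] by (auto simp: R_def)
  have fR: "f x \<in> R" if "x \<in> S" "x \<notin> ?Z" for x
    using that f_less f_ne_Z by (fastforce simp: R_def)
  have "r (f x) < card R" if "x \<in> S" "x \<notin> ?Z" for x
    using bij_betwE[OF r] fR[OF that] by simp
  moreover have "r (f x) \<noteq> r (f y)"
    if "x \<in> S" "x \<notin> ?Z" "y \<in> S" "y \<notin> ?Z" "x \<noteq> y" "m x y = m y x" for x y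
    using bij_betw_imp_inj_on[OF r] fR[of x] fR[of y] f_ne[of x y] that by (auto dest: inj_onD)
  ultimately have "proper_colouring (commuting_graph S m) (card R) (r \<circ> f)"
    by (auto simp: proper_colouring_def commuting_graph_def)
  then have "?k \<le> card R"
    by (rule chromatic_number_le)
  then show "card ?Z + ?k \<le> ?n"
    using cardR le by linarith
qed

text \<open>
  Comparing the outer coordinates of the two products forces \<open>i = j\<close> and \<open>l = k\<close>; the middle
  coordinates then give \<open>x p y = y p x\<close> with \<open>p = P l i\<close>, which is multiplied by \<open>p\<close> from the left.
\<close>

lemma rees_mult_commute_iff:
  assumes "group G" and "P l i \<in> carrier G" "x \<in> carrier G" "y \<in> carrier G"
  shows "rees_mult G P (i, x, l) (j, y, k) = rees_mult G P (j, y, k) (i, x, l) \<longleftrightarrow>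
           i = j \<and> l = k \<and>
           (P l i \<otimes>\<^bsub>G\<^esub> x) \<otimes>\<^bsub>G\<^esub> (P l i \<otimes>\<^bsub>G\<^esub> y) = (P l i \<otimes>\<^bsub>G\<^esub> y) \<otimes>\<^bsub>G\<^esub> (P l i \<otimes>\<^bsub>G\<^esub> x)"
proof -
  interpret group G by (rule assms)
  let ?p = "P l i"
  have "?p \<otimes>\<^bsub>G\<^esub> x \<otimes>\<^bsub>G\<^esub> (?p \<otimes>\<^bsub>G\<^esub> y) = ?p \<otimes>\<^bsub>G\<^esub> (x \<otimes>\<^bsub>G\<^esub> ?p \<otimes>\<^bsub>G\<^esub> y)"
    and "?p \<otimes>\<^bsub>G\<^esub> y \<otimes>\<^bsub>G\<^esub> (?p \<otimes>\<^bsub>G\<^esub> x) = ?p \<otimes>\<^bsub>G\<^esub> (y \<otimes>\<^bsub>G\<^esub> ?p \<otimes>\<^bsub>G\<^esub> x)"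
    using assms(2-) by (simp_all add: m_assoc)
  then show ?thesis
    using assms(2-) by (auto simp: rees_mult_def)
qed

text \<open>An element does not commute with one from another row or another column.\<close>

lemma semigroup_center_rees_empty:
  assumes "group G" and "\<forall>l\<in>\<Lambda>. \<forall>i\<in>I. P l i \<in> carrier G"
    and "card I > 1 \<or> card \<Lambda> > 1" and "I \<noteq> {}" and "\<Lambda> \<noteq> {}"
  shows "semigroup_center (rees_carrier G I \<Lambda>) (rees_mult G P) = {}"
proof -
  interpret group G by (rule assms)
  have other: "\<exists>b\<in>A. b \<noteq> a" if "card A > 1" for A :: "'z set" and a
    using that by (metis card_le_Suc0_iff_eq card.infinite One_nat_def not_less not_less_zero)
  have "\<exists>b\<in>rees_carrier G I \<Lambda>. rees_mult G P a b \<noteq> rees_mult G P b a"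
    if a_in: "a \<in> rees_carrier G I \<Lambda>" for a
  proof -
    obtain i x l where a: "a = (i, x, l)" "i \<in> I" "x \<in> carrier G" "l \<in> \<Lambda>"
      using a_in by (auto simp: rees_carrier_def)
    obtain j k where "j \<in> I" "k \<in> \<Lambda>" "j \<noteq> i \<or> k \<noteq> l"
      using assms(3) other[of I i] other[of \<Lambda> l] a by blast
    then have "(j, \<one>\<^bsub>G\<^esub>, k) \<in> rees_carrier G I \<Lambda>"
      and "rees_mult G P a (j, \<one>\<^bsub>G\<^esub>, k) \<noteq> rees_mult G P (j, \<one>\<^bsub>G\<^esub>, k) a"
      by (auto simp: a(1) rees_carrier_def rees_mult_def)
    then show ?thesis by blast
  qed
  then show ?thesis by (auto simp: semigroup_center_def)
qed

text \<open>
  One homomorphism sends \<open>(i, x, l)\<close> to \<open>P l i \<otimes> x\<close>; it identifies each of the disjoint copies with the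
  full commuting graph of the group. The other is the inverse of this identification for one
  fixed pair \<open>(i, l)\<close>.
\<close>

lemma chromatic_number_rees:
  assumes "group G" and fin: "finite (carrier G)" "finite I" "finite \<Lambda>"
    and ne: "I \<noteq> {}" "\<Lambda> \<noteq> {}"
    and P: "\<forall>l\<in>\<Lambda>. \<forall>i\<in>I. P l i \<in> carrier G"
    and card: "card I > 1 \<or> card \<Lambda> > 1"
  shows "chromatic_number (commuting_graph (rees_carrier G I \<Lambda>) (rees_mult G P))
           = chromatic_number (full_commuting_graph (carrier G) (\<otimes>\<^bsub>G\<^esub>))"
    (is "chromatic_number ?R = chromatic_number ?F")
proof (rule antisym)
  interpret group G by (rule assms)
  have comm: "rees_mult G P (i, x, l) (j, y, k) = rees_mult G P (j, y, k) (i, x, l) \<longleftrightarrow>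
      i = j \<and> l = k \<and>
      (P l i \<otimes>\<^bsub>G\<^esub> x) \<otimes>\<^bsub>G\<^esub> (P l i \<otimes>\<^bsub>G\<^esub> y) = (P l i \<otimes>\<^bsub>G\<^esub> y) \<otimes>\<^bsub>G\<^esub> (P l i \<otimes>\<^bsub>G\<^esub> x)"
    if "i \<in> I" "l \<in> \<Lambda>" "x \<in> carrier G" "y \<in> carrier G" for i x l j y k
    using rees_mult_commute_iff[OF assms(1), of P l i x y j k] P that by blast
  have verts: "pverts ?R = rees_carrier G I \<Lambda>"
    and arcs: "parcs ?R = {(a, b). a \<in> rees_carrier G I \<Lambda> \<and> b \<in> rees_carrier G I \<Lambda>
                             \<and> a \<noteq> b \<and> rees_mult G P a b = rees_mult G P b a}"
    by (auto simp: commuting_graph_def semigroup_center_rees_empty[OF assms(1) P card ne])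

  show "chromatic_number ?R \<le> chromatic_number ?F"
  proof (rule chromatic_number_le_of_hom)
    let ?h = "\<lambda>(i, x, l). P l i \<otimes>\<^bsub>G\<^esub> x"
    show "pair_graph ?F"
      by (rule pair_graph_full_commuting_graph[OF fin(1)])
    show "?h v \<in> pverts ?F" if "v \<in> pverts ?R" for v
      using that[unfolded verts] P by (auto simp: rees_carrier_def full_commuting_graph_def)
    show "(?h u, ?h v) \<in> parcs ?F" if "(u, v) \<in> parcs ?R" for u v
      using that[unfolded arcs] P comm by (auto simp: rees_carrier_def full_commuting_graph_def)
  qed

  obtain i l where il: "i \<in> I" "l \<in> \<Lambda>"
    using ne by blast
  let ?p = "P l i"
  have p: "?p \<in> carrier G"
    using P il by blast
  have cancel: "?p \<otimes>\<^bsub>G\<^esub> (inv\<^bsub>G\<^esub> ?p \<otimes>\<^bsub>G\<^esub> x) = x" if "x \<in> carrier G" for x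
    using p that by (simp add: m_assoc[symmetric])
  show "chromatic_number ?F \<le> chromatic_number ?R"
  proof (rule chromatic_number_le_of_hom)
    let ?h = "\<lambda>x. (i, inv\<^bsub>G\<^esub> ?p \<otimes>\<^bsub>G\<^esub> x, l)"
    show "pair_graph ?R"
      using fin by (intro pair_graph_commuting_graph) (simp add: rees_carrier_def)
    show "?h v \<in> pverts ?R" if "v \<in> pverts ?F" for v
      unfolding verts using that il p by (auto simp: rees_carrier_def full_commuting_graph_def)
    show "(?h u, ?h v) \<in> parcs ?R" if "(u, v) \<in> parcs ?F" for u v
      unfolding arcs using that il p by (auto simp: rees_carrier_def full_commuting_graph_def comm cancel)
  qed
qed

text \<open>The commuting graph of a commutative semigroup has no vertices, so the empty set of colours suffices.\<close>

lemma chromatic_number_commuting_graph_commutative: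
  assumes "\<And>x y. x \<in> S \<Longrightarrow> y \<in> S \<Longrightarrow> m x y = m y x"
  shows "semigroup_center S m = S" and "chromatic_number (commuting_graph S m) = 0"
proof -
  show center: "semigroup_center S m = S"
    using assms by (auto simp: semigroup_center_def)
  have "proper_colouring (commuting_graph S m) 0 c" for c
    by (auto simp: proper_colouring_def commuting_graph_def center)
  then show "chromatic_number (commuting_graph S m) = 0"
    using chromatic_number_le by blast
qed

theorem theorem3p9:
  fixes G :: "('g, 'm) monoid_scheme" and I :: "'i set" and \<Lambda> :: "'l set"
    and P :: "'l \<Rightarrow> 'i \<Rightarrow> 'g"
  assumes "group G" and "finite (carrier G)"
    and "finite I" and "I \<noteq> {}" and "finite \<Lambda>" and "\<Lambda> \<noteq> {}"
    and "\<forall>l\<in>\<Lambda>. \<forall>i\<in>I. P l i \<in> carrier G"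
    and "card I > 1 \<or> card \<Lambda> > 1"
  shows "(comm_group G \<longrightarrow>
            chromatic_number (commuting_graph (rees_carrier G I \<Lambda>) (rees_mult G P))
              = card (carrier G)) \<and>
         (\<not> comm_group G \<longrightarrow>
            chromatic_number (commuting_graph (rees_carrier G I \<Lambda>) (rees_mult G P))
              = card (semigroup_center (carrier G) (\<otimes>\<^bsub>G\<^esub>))
                + chromatic_number (commuting_graph (carrier G) (\<otimes>\<^bsub>G\<^esub>)))"
proof -
  have eq: "chromatic_number (commuting_graph (rees_carrier G I \<Lambda>) (rees_mult G P))
      = card (semigroup_center (carrier G) (\<otimes>\<^bsub>G\<^esub>))
        + chromatic_number (commuting_graph (carrier G) (\<otimes>\<^bsub>G\<^esub>))"
    using chromatic_number_rees[OF assms(1,2,3,5,4,6,7,8)]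
      chromatic_number_full_commuting_graph[OF assms(2)] by simp
  have "x \<otimes>\<^bsub>G\<^esub> y = y \<otimes>\<^bsub>G\<^esub> x"
    if "comm_group G" "x \<in> carrier G" "y \<in> carrier G" for x y
  proof -
    interpret comm_group G by (rule that(1))
    show ?thesis using that(2,3) by (rule m_comm)
  qed
  then show ?thesis
    using eq chromatic_number_commuting_graph_commutative[of "carrier G" "(\<otimes>\<^bsub>G\<^esub>)"] by simp
qed

end
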